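(* Let $\mathcal{X}$ be a Banach space with dual $\mathcal{X}^*$ and metric $d(x,y)=\|x-y\|$, and let $f\colon\mathcal{X}\to\mathbb{R}\cup\{+\infty\}$ be a closed function. Consider a sequence of points $x_k\in\mathcal{X}$ with $f(x_k)$ finite and closed functions $f_{x_k}\colon\mathcal{X}\to\mathbb{R}\cup\{+\infty\}$ satisfying $$|f_{x_k}(y)-f(y)|\leq\omega_1(d(y,x_k))\quad\text{for all indices } k\text{ and all points } y\in\mathcal{X},$$ where $\omega_1$ is some proper growth function. Suppose that $$f_{x_k}(y)\geq f_{x_k}(x_{k+1})+\langle v_{k+1},y-x_{k+1}\rangle-\omega_2(d(y,x_{k+1}))\quad\text{for all } k\text{ and all } y\in\mathcal{X},$$ where $\omega_2$ is some proper growth function and $v_k\in\mathcal{X}^*$ are some dual elements. Assume moreover that $d(x_{k+1},x_k)$ and $\|v_k\|$ tend to zero. If $(x^*,f(x^* ))\in\mathcal{X}\times\mathbb{R}$ is a limit point (i.e. the limit of a subsequence) of the sequence $(x_k,f(x_k))$, then $x^*$ is stationary for $f$.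
   Context: A function is called closed if it is lower-semicontinuous. $\langle v,x\rangle:=v(x)$ for $v\in\mathcal{X}^*$, and $\|v\|$ is the dual norm. A growth function is a differentiable function $\omega\colon[0,\infty)\to[0,\infty)$ (one-sided derivative at $0$) with $\omega(0)=\omega'(0)=0$ and $\omega'>0$ on $(0,\infty)$; it is proper if in addition $\lim_{t\to0^+}\omega'(t)=\lim_{t\to 0^+}\omega(t)/\omega'(t)=0$. The slope of $f$ at a point $\bar x$ with $f(\bar x)$ finite is $|\nabla f|(\bar x):=\limsup_{x\to\bar x,\,x\ne\bar x}\frac{(f(\bar x)-f(x))^+}{d(\bar x,x)}$, where $r^+=\max\{0,r\}$ (it is $0$ if $\bar x$ is isolated). The limiting slope is $\overline{|\nabla f|}(\bar x):=\liminf_{x\to\bar x,\,f(x)\to f(\bar x)}|\nabla f|(x)$, where $x=\bar x$ is allowed in the liminf. A point $\bar x$ is stationary for $f$ if $\overline{|\nabla f|}(\bar x)=0$. The inequality $|f_{x_k}(y)-f(y)|\le\omega_1(d(y,x_k))$ is understood to mean that $f_{x_k}(y)$ and $f(y)$ are either both $+\infty$ or both finite and satisfying the inequality. *)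

theory Defs
  imports "HOL-Analysis.Analysis"
begin

text \<open>Functions with values in \<open>\<real> \<union> {+\<infinity>}\<close> are rendered as \<^typ>\<open>ereal\<close>-valued functions that
  omit the value \<open>-\<infinity>\<close>; closed means lower semicontinuous.\<close>

definition closed_fun :: "('a::topological_space \<Rightarrow> ereal) \<Rightarrow> bool" where
  "closed_fun f \<longleftrightarrow> (\<forall>x. f x \<noteq> -\<infinity>) \<and> (\<forall>x. f x \<le> Liminf (at x) f)"

text \<open>A growth function lives on \<open>[0,\<infinity>)\<close>, so \<open>\<omega>\<close> and its derivative \<open>\<omega>'\<close> are only constrained
  there. The derivative is taken within \<open>[0,\<infinity>)\<close>: it is one-sided at \<open>0\<close>, two-sided elsewhere,
  and \<open>\<omega>'\<close> is uniquely determined on \<open>[0,\<infinity>)\<close>.\<close>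

definition growth_fun_deriv :: "(real \<Rightarrow> real) \<Rightarrow> (real \<Rightarrow> real) \<Rightarrow> bool" where
  "growth_fun_deriv \<omega> \<omega>' \<longleftrightarrow>
     (\<forall>t\<ge>0. 0 \<le> \<omega> t) \<and>
     (\<forall>t\<ge>0. (\<omega> has_real_derivative \<omega>' t) (at t within {0..})) \<and>
     \<omega> 0 = 0 \<and> \<omega>' 0 = 0 \<and> (\<forall>t>0. 0 < \<omega>' t)"

definition proper_growth_fun :: "(real \<Rightarrow> real) \<Rightarrow> bool" where
  "proper_growth_fun \<omega> \<longleftrightarrow>
     (\<exists>\<omega>'. growth_fun_deriv \<omega> \<omega>' \<and>
        (\<omega>' \<longlongrightarrow> 0) (at_right 0) \<and> ((\<lambda>t. \<omega> t / \<omega>' t) \<longlongrightarrow> 0) (at_right 0))"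

text \<open>The slope is meaningful only where \<open>f x\<close> is finite.  The case distinction handles isolated
  points, where \<^const>\<open>Limsup\<close> along the trivial filter would be \<open>-\<infinity>\<close>.\<close>

definition slope :: "('a::metric_space \<Rightarrow> ereal) \<Rightarrow> 'a \<Rightarrow> ereal" where
  "slope f x = (if at x = bot then 0
     else Limsup (at x) (\<lambda>y. max 0 (f x - f y) / ereal (dist x y)))"

text \<open>The filter expresses \<open>y \<rightarrow> x\<close> together with \<open>f y \<rightarrow> f x\<close>, with \<open>y = x\<close> allowed. If \<open>f x\<close> is
  finite, then \<open>f y\<close> is eventually finite along it, so only genuine slopes contribute.\<close>

definition limiting_slope :: "('a::metric_space \<Rightarrow> ereal) \<Rightarrow> 'a \<Rightarrow> ereal" where
  "limiting_slope f x = Liminf (inf (nhds x) (filtercomap f (nhds (f x)))) (slope f)"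

definition stationary :: "('a::metric_space \<Rightarrow> ereal) \<Rightarrow> 'a \<Rightarrow> bool" where
  "stationary f x \<longleftrightarrow> \<bar>f x\<bar> \<noteq> \<infinity> \<and> limiting_slope f x = 0"

text \<open>The inequality \<open>|a - b| \<le> c\<close> for \<open>a, b \<in> \<real> \<union> {+\<infinity>}\<close>: both are \<open>+\<infinity>\<close>, or both are finite and the
  inequality holds.\<close>

definition ext_close :: "ereal \<Rightarrow> ereal \<Rightarrow> real \<Rightarrow> bool" where
  "ext_close a b c \<longleftrightarrow>
     (a = \<infinity> \<and> b = \<infinity>) \<or> (\<bar>a\<bar> \<noteq> \<infinity> \<and> \<bar>b\<bar> \<noteq> \<infinity> \<and> \<bar>a - b\<bar> \<le> ereal c)"

end

theory Submission
  imports Defs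
begin

text \<open>Adding the two model inequalities shows that \<open>x\<^sub>k\<^sub>+\<^sub>1\<close> minimizes
  \<open>y \<mapsto> f y - \<langle>v\<^sub>k\<^sub>+\<^sub>1, y - x\<^sub>k\<^sub>+\<^sub>1\<rangle> + \<omega>\<^sub>2 (d y x\<^sub>k\<^sub>+\<^sub>1) + \<omega>\<^sub>1 (d y x\<^sub>k)\<close> up to the error
  \<open>2 \<omega>\<^sub>1 (d x\<^sub>k\<^sub>+\<^sub>1 x\<^sub>k)\<close>, which tends to \<open>0\<close>. Ekeland's variational principle with slope and radius both
  \<open>\<epsilon>\<close> gives a point within \<open>\<epsilon>\<close> of \<open>x\<^sub>k\<^sub>+\<^sub>1\<close> at which \<open>f\<close> is not much larger than
  \<open>f x\<^sub>k\<^sub>+\<^sub>1\<close> and the slope of \<open>f\<close> is bounded by \<open>\<epsilon>\<close> plus the norm of \<open>v\<^sub>k\<^sub>+\<^sub>1\<close> and the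
  derivatives of the growth functions near \<open>0\<close>.\<close>

section \<open>Closed functions and continuous perturbations\<close>

lemma closed_fun_eventually_greater:
  assumes "closed_fun f" "c < f x"
  shows "\<forall>\<^sub>F y in nhds x. c < f y"
  using assms unfolding closed_fun_def eventually_nhds_conv_at le_Liminf_iff by blast

lemma closed_fun_add_continuous:
  fixes f :: "'a::topological_space \<Rightarrow> ereal" and \<phi> :: "'a \<Rightarrow> real"
  assumes f: "closed_fun f" and \<phi>: "continuous_on UNIV \<phi>"
  shows "closed_fun (\<lambda>y. f y + ereal (\<phi> y))"
  unfolding closed_fun_def
proof (intro conjI allI)
  fix x
  show "f x + ereal (\<phi> x) \<noteq> -\<infinity>"
    using f by (simp add: closed_fun_def)
  show "f x + ereal (\<phi> x) \<le> Liminf (at x) (\<lambda>y. f y + ereal (\<phi> y))"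
    unfolding le_Liminf_iff
  proof (intro allI impI)
    fix c assume c: "c < f x + ereal (\<phi> x)"
    then have "c - ereal (\<phi> x) < f x"
      by (simp add: ereal_minus_less)
    \<comment> \<open>Since \<open>f x\<close> may be \<open>\<infinity>\<close>, a real
      \<open>b\<close> strictly below it takes its place; \<open>b + \<phi> y\<close> is real-valued
      and continuous at \<open>x\<close>, so an ordinary limit argument applies.\<close>
    then obtain b where b: "c - ereal (\<phi> x) < ereal b" "ereal b < f x"
      using ereal_dense2 by blast
    have "\<phi> \<midarrow>x\<rightarrow> \<phi> x"
      using \<phi> by (simp add: continuous_on_def)
    then have lim: "((\<lambda>y. ereal b + ereal (\<phi> y)) \<longlongrightarrow> ereal b + ereal (\<phi> x)) (at x)"
      by (auto intro!: tendsto_intros)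
    have "c < ereal b + ereal (\<phi> x)"
      using b(1) by (simp add: ereal_minus_less)
    with lim have "\<forall>\<^sub>F y in at x. c < ereal b + ereal (\<phi> y)"
      by (rule order_tendstoD)
    moreover have "\<forall>\<^sub>F y in at x. ereal b < f y"
      using closed_fun_eventually_greater[OF f b(2)] by (simp add: eventually_nhds_conv_at)
    ultimately show "\<forall>\<^sub>F y in at x. c < f y + ereal (\<phi> y)"
    proof eventually_elim
      case (elim y)
      have "ereal b + ereal (\<phi> y) \<le> f y + ereal (\<phi> y)"
        using elim(2) by (intro add_right_mono) simp
      with elim(1) show ?case by (rule less_le_trans)
    qed
  qed
qed

lemma closed_fun_closed_sublevel:
  assumes "closed_fun f"
  shows "closed {y. f y \<le> c}"
proof -
  have "open {y. c < f y}"
    unfolding open_subopen[of "{y. c < f y}"]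
    using closed_fun_eventually_greater[OF assms] by (fastforce simp: eventually_nhds)
  moreover have "- {y. c < f y} = {y. f y \<le> c}"
    by auto
  ultimately show ?thesis
    by (metis closed_Compl)
qed

section \<open>Ekeland's variational principle\<close>

text \<open>Call \<open>y\<close> below \<open>w\<close> if moving from \<open>w\<close> to
  \<open>y\<close> lowers \<open>f\<close> by at least \<open>e\<close> times the distance. This is
  a partial order on the points where \<open>f\<close> is finite; a greedy descent from
  \<open>x\<close> converges by completeness, and its limit \<open>z\<close> is minimal, which is
  the strict inequality off \<open>z\<close>.\<close>

lemma ekeland_variational_principle:
  fixes f :: "'a::complete_space \<Rightarrow> ereal"
  assumes f: "closed_fun f" and bdd: "\<And>y. ereal m \<le> f y" and x: "f x \<noteq> \<infinity>" and e: "e > 0"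
  obtains z where "f z + ereal (e * dist z x) \<le> f x"
    and "\<And>y. y \<noteq> z \<Longrightarrow> f z < f y + ereal (e * dist y z)"
proof -
  \<comment> \<open>\<open>S w\<close> is the set of points below \<open>w\<close> in this order. It
    is closed by semicontinuity, and transitivity is the triangle inequality.\<close>
  define S where "S = (\<lambda>w. {y. f y + ereal (e * dist y w) \<le> f w})"
  have closed: "closed (S w)" for w
    unfolding S_def
    by (intro closed_fun_closed_sublevel closed_fun_add_continuous f continuous_intros)
  have refl: "w \<in> S w" for w
    by (simp add: S_def flip: zero_ereal_def)
  have trans: "y \<in> S w" if "y \<in> S u" "u \<in> S w" for y u w
  proof -
    have "e * dist y w \<le> e * dist y u + e * dist u w"
      using e by (metis dist_triangle distrib_left mult_left_mono less_imp_le)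
    then have "f y + ereal (e * dist y w) \<le> f y + ereal (e * dist y u + e * dist u w)"
      by (intro add_left_mono) simp
    also have "\<dots> = (f y + ereal (e * dist y u)) + ereal (e * dist u w)"
      by (simp add: add.assoc flip: plus_ereal.simps(1))
    also have "\<dots> \<le> f u + ereal (e * dist u w)"
      using that(1) unfolding S_def by (intro add_right_mono) simp
    also have "\<dots> \<le> f w"
      using that(2) by (simp add: S_def)
    finally show ?thesis
      by (simp add: S_def)
  qed
  have fin_S: "f y \<noteq> \<infinity>" if "f w \<noteq> \<infinity>" "y \<in> S w" for y w
    using that by (cases "f y") (auto simp: S_def)
  \<comment> \<open>The infimum over \<open>S w\<close> lies between \<open>m\<close> and
    \<open>f w\<close>, hence is real and can be approached within any \<open>d > 0\<close>.\<close>
  have near_inf: "\<exists>u \<in> S w. \<forall>y \<in> S w. f u \<le> f y + ereal d" if w: "f w \<noteq> \<infinity>" and d: "d > 0" for w d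
  proof -
    have "Inf (f ` S w) \<le> f w"
      using refl by (simp add: INF_lower)
    moreover have "ereal m \<le> Inf (f ` S w)"
      using bdd by (simp add: le_INF_iff)
    ultimately obtain i where i: "Inf (f ` S w) = ereal i"
      using w by (cases "Inf (f ` S w)") auto
    then have "Inf (f ` S w) < ereal (i + d)"
      using d by simp
    then obtain u where u: "u \<in> S w" "f u < ereal (i + d)"
      by (auto simp: Inf_less_iff)
    have "f u \<le> f y + ereal d" if "y \<in> S w" for y
    proof -
      have "ereal i \<le> f y"
        using that i by (metis INF_lower)
      then have "ereal i + ereal d \<le> f y + ereal d"
        by (rule add_right_mono)
      then show ?thesis
        using u(2) by (simp add: order.trans less_imp_le)
    qed
    with u(1) show ?thesis by blast
  qed
  \<comment> \<open>Finiteness of \<open>f (z n)\<close> is carried along because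
    \<open>near_inf\<close> requires it at every stage. The tolerance contains the factor
    \<open>e\<close> so that the distances below come out as pure powers of
    \<open>1/2\<close>.\<close>
  have "\<exists>z. \<forall>n. (f (z n) \<noteq> \<infinity> \<and> (n = 0 \<longrightarrow> z n = x)) \<and> z (Suc n) \<in> S (z n) \<and>
      (\<forall>y \<in> S (z n). f (z (Suc n)) \<le> f y + ereal (e * (1/2) ^ n))"
  proof (rule dependent_nat_choice)
    show "\<exists>w. f w \<noteq> \<infinity> \<and> ((0::nat) = 0 \<longrightarrow> w = x)"
      using x by blast
    fix w and n :: nat
    assume "f w \<noteq> \<infinity> \<and> (n = 0 \<longrightarrow> w = x)"
    then show "\<exists>u. (f u \<noteq> \<infinity> \<and> (Suc n = 0 \<longrightarrow> u = x)) \<and> u \<in> S w \<and>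
        (\<forall>y \<in> S w. f u \<le> f y + ereal (e * (1/2) ^ n))"
      using near_inf[of w "e * (1/2) ^ n"] fin_S e by (metis mult_pos_pos nat.distinct(1)
          zero_less_power half_gt_zero zero_less_one)
  qed
  then obtain z where z: "\<And>n. f (z n) \<noteq> \<infinity>" "z 0 = x" "\<And>n. z (Suc n) \<in> S (z n)"
      "\<And>n y. y \<in> S (z n) \<Longrightarrow> f (z (Suc n)) \<le> f y + ereal (e * (1/2) ^ n)"
    by metis
  have z_mono: "z n \<in> S (z k)" if "k \<le> n" for k n
    using that by (induction n rule: dec_induct) (use refl trans z(3) in blast)+
  \<comment> \<open>By transitivity \<open>y\<close> also competes in \<open>S (z n)\<close>, so
    \<open>f\<close> can drop by at most \<open>e * (1/2) ^ n\<close> from \<open>z (Suc n)\<close>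
    to \<open>y\<close>; being below \<open>z (Suc n)\<close> costs a drop of \<open>e\<close> times
    the distance.\<close>
  have small: "dist y (z (Suc n)) \<le> (1/2) ^ n" if y: "y \<in> S (z (Suc n))" for y n
  proof -
    have "f y + ereal (e * dist y (z (Suc n))) \<le> f (z (Suc n))"
      using y by (simp add: S_def)
    also have "\<dots> \<le> f y + ereal (e * (1/2) ^ n)"
      using z(3,4) y trans by blast
    finally have "f y + ereal (e * dist y (z (Suc n))) \<le> f y + ereal (e * (1/2) ^ n)" .
    moreover have "f y \<noteq> \<infinity>" "f y \<noteq> -\<infinity>"
      using fin_S[OF z(1) y] bdd[of y] by auto
    ultimately show ?thesis
      using e by (cases "f y") auto
  qed
  have half: "(\<lambda>n. (1/2 :: real) ^ n) \<longlonglongrightarrow> 0"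
    by (rule LIMSEQ_power_zero) simp
  have "Cauchy z"
  proof (rule metric_CauchyI)
    fix d :: real assume "d > 0"
    with half have "\<forall>\<^sub>F n in sequentially. (1/2) ^ n < d / 2"
      by (intro order_tendstoD) auto
    then obtain N where N: "(1/2) ^ N < d / 2"
      by (auto simp: eventually_sequentially)
    have "dist (z i) (z j) < d" if "i \<ge> Suc N" "j \<ge> Suc N" for i j
      using small[OF z_mono[OF that(1)]] small[OF z_mono[OF that(2)]] N
        dist_triangle2[of "z i" "z j" "z (Suc N)"] by linarith
    then show "\<exists>M. \<forall>i\<ge>M. \<forall>j\<ge>M. dist (z i) (z j) < d"
      by blast
  qed
  then obtain u where u: "z \<longlonglongrightarrow> u"
    using Cauchy_convergent unfolding convergent_def by blast
  have u_S: "u \<in> S (z n)" for n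
  proof (rule Lim_in_closed_set[OF closed _ _ u])
    show "\<forall>\<^sub>F i in sequentially. z i \<in> S (z n)"
      using z_mono by (auto simp: eventually_sequentially)
  qed simp
  \<comment> \<open>A point below \<open>u\<close> is below every \<open>z n\<close>, so
    \<open>small\<close> makes it a limit of the same sequence.\<close>
  have "y = u" if "y \<in> S u" for y
  proof -
    have "(\<lambda>n. dist y (z (Suc n))) \<longlonglongrightarrow> 0"
    proof (rule tendsto_sandwich[OF _ _ tendsto_const half])
      show "\<forall>\<^sub>F n in sequentially. dist y (z (Suc n)) \<le> (1/2) ^ n"
        using small trans[OF that u_S] by simp
    qed simp
    moreover have "(\<lambda>n. dist y (z (Suc n))) \<longlonglongrightarrow> dist y u"
      by (intro tendsto_intros LIMSEQ_Suc u)
    ultimately have "dist y u = 0"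
      using LIMSEQ_unique by blast
    then show ?thesis by simp
  qed
  then have "f u < f y + ereal (e * dist y u)" if "y \<noteq> u" for y
    using that unfolding S_def by (metis mem_Collect_eq not_le)
  moreover have "f u + ereal (e * dist u x) \<le> f x"
    using u_S[of 0] z(2) by (simp add: S_def)
  ultimately show ?thesis
    using that by blast
qed

section \<open>Slopes and a criterion for stationarity\<close>

lemma slope_nonneg: "0 \<le> slope f x"
proof (cases "at x = bot")
  case False
  have "0 \<le> Liminf (at x) (\<lambda>y. max 0 (f x - f y) / ereal (dist x y))"
    by (intro Liminf_bounded always_eventually allI zero_le_divide_ereal) auto
  also have "\<dots> \<le> Limsup (at x) (\<lambda>y. max 0 (f x - f y) / ereal (dist x y))"
    by (rule Liminf_le_Limsup) (simp add: False)
  finally show ?thesis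
    by (simp add: slope_def False)
qed (simp add: slope_def)

lemma slope_leI:
  assumes fin: "\<bar>f x\<bar> \<noteq> \<infinity>" and c: "0 \<le> c"
    and le: "\<forall>\<^sub>F y in at x. f x \<le> f y + ereal (c * dist x y)"
  shows "slope f x \<le> ereal c"
proof (cases "at x = bot")
  case False
  have "\<forall>\<^sub>F y in at x. y \<noteq> x"
    by (simp add: eventually_at_filter)
  with le have "\<forall>\<^sub>F y in at x. max 0 (f x - f y) / ereal (dist x y) \<le> ereal c"
  proof eventually_elim
    case (elim y)
    have "f x - f y \<le> ereal (c * dist x y)"
      using elim(1) fin by (cases "f x"; cases "f y") auto
    then have "max 0 (f x - f y) \<le> ereal (dist x y) * ereal c"
      using c by (simp add: mult.commute)
    then show ?case
      using elim(2) by (simp add: ereal_divide_le_pos)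
  qed
  then show ?thesis
    by (simp add: slope_def False Limsup_bounded)
qed (use c in \<open>simp add: slope_def\<close>)

text \<open>A one-sided bound on \<open>f y\<close> suffices: semicontinuity supplies the lower
  bound near \<open>x\<close>, so the approximating points converge in value as well. Slopes are
  nonnegative, so only positivity of the limiting slope has to be excluded.\<close>

lemma stationaryI:
  assumes f: "closed_fun f" and fin: "\<bar>f x\<bar> \<noteq> \<infinity>"
    and approx: "\<And>e. e > 0 \<Longrightarrow> \<exists>y. dist y x < e \<and> f y < f x + ereal e \<and> slope f y \<le> ereal e"
  shows "stationary f x"
proof -
  let ?F = "inf (nhds x) (filtercomap f (nhds (f x)))"
  have "Liminf ?F (slope f) \<le> 0"
  proof (rule ccontr)
    assume "\<not> ?thesis"
    then obtain c where c: "0 < ereal c" "ereal c < Liminf ?F (slope f)"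
      using ereal_dense2[of 0] by (auto simp: not_le)
    have "\<forall>\<^sub>F y in ?F. ereal c < slope f y"
      by (rule less_LiminfD[OF c(2)])
    then obtain P Q where P: "eventually P (nhds x)" and Q: "eventually Q (nhds (f x))"
      and PQ: "\<And>y. P y \<Longrightarrow> Q (f y) \<Longrightarrow> ereal c < slope f y"
      unfolding eventually_inf eventually_filtercomap by metis
    obtain U where U: "open U" "f x \<in> U" "\<And>t. t \<in> U \<Longrightarrow> Q t"
      using Q by (auto simp: eventually_nhds)
    obtain b where b: "b > 0" "{f x - b <..< f x + b} \<subseteq> U"
      using ereal_open_cont_interval[OF U(1,2) fin] by metis
    obtain d where d: "d > 0" "ereal d < b"
      using ereal_dense2[OF b(1)] by auto
    have "f x - b \<le> f x - ereal d" "f x + ereal d \<le> f x + b"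
      using d(2) by (auto intro: ereal_minus_mono add_left_mono)
    then have d_U: "{f x - ereal d <..< f x + ereal d} \<subseteq> U"
      using b(2) by (meson greaterThanLessThan_iff le_less_trans less_le_trans subset_iff)
    have "f x - ereal d < f x"
      using fin d(1) by (cases "f x") auto
    with P have "\<forall>\<^sub>F y in nhds x. P y \<and> f x - ereal d < f y"
      by (intro eventually_conj closed_fun_eventually_greater[OF f])
    then obtain d' where d': "d' > 0" "\<And>y. dist y x < d' \<Longrightarrow> P y \<and> f x - ereal d < f y"
      by (auto simp: eventually_nhds_metric)
    \<comment> \<open>\<open>e \<le> d'\<close> puts \<open>y\<close> where \<open>P\<close> and the
      lower bound on \<open>f\<close> hold, \<open>e \<le> d\<close> keeps \<open>f y\<close> in
      \<open>U\<close>, and \<open>e \<le> c\<close> contradicts the lower bound on the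
      slope.\<close>
    define e where "e = min c (min d d')"
    have e: "e > 0" "e \<le> c" "e \<le> d" "e \<le> d'"
      using c(1) d(1) d'(1) by (auto simp: e_def)
    obtain y where y: "dist y x < e" "f y < f x + ereal e" "slope f y \<le> ereal e"
      using approx[OF e(1)] by blast
    have "f x + ereal e \<le> f x + ereal d"
      using e(3) by (intro add_left_mono) simp
    then have "Q (f y)"
      using d'(2)[of y] y(1,2) e(4) d_U U(3) by (meson greaterThanLessThan_iff less_le_trans subsetD)
    with d'(2)[of y] y(1) e(4) have "ereal c < slope f y"
      by (auto intro: PQ)
    with y(3) e(2) show False
      by (metis ereal_less_eq(3) less_le_trans not_le)
  qed
  moreover have "0 \<le> Liminf ?F (slope f)"
    by (intro Liminf_bounded always_eventually allI slope_nonneg)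
  ultimately show ?thesis
    using fin by (simp add: stationary_def limiting_slope_def)
qed

section \<open>Growth functions of the distance\<close>

lemma growth_fun_deriv_continuous_dist:
  assumes "growth_fun_deriv \<omega> \<omega>'"
  shows "continuous_on UNIV (\<lambda>y. \<omega> (dist y a))"
proof -
  have "continuous_on {0..} \<omega>"
    using assms unfolding growth_fun_deriv_def
    by (auto intro!: DERIV_continuous_on)
  then show ?thesis
    by (rule continuous_on_compose2) (auto intro!: continuous_intros)
qed

lemma growth_fun_deriv_nonneg:
  assumes "growth_fun_deriv \<omega> \<omega>'" "0 \<le> t"
  shows "0 \<le> \<omega>' t"
  using assms by (cases "t = 0") (auto simp: growth_fun_deriv_def less_imp_le)

text \<open>First-order expansion of \<open>\<omega>\<close> at \<open>dist z a\<close>, combined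
  with the fact that the distance to \<open>a\<close> is 1-Lipschitz. The one-sided derivative
  suffices when \<open>z = a\<close>, since distances are nonnegative.\<close>

lemma growth_fun_deriv_eventually_le:
  fixes z a :: "'a::metric_space"
  assumes g: "growth_fun_deriv \<omega> \<omega>'" and e: "e > 0"
  shows "\<forall>\<^sub>F y in nhds z. \<omega> (dist y a) \<le> \<omega> (dist z a) + (\<omega>' (dist z a) + e) * dist z y"
proof -
  have "(\<omega> has_derivative (*) (\<omega>' (dist z a))) (at (dist z a) within {0..})"
    using g by (simp add: growth_fun_deriv_def has_field_derivative_def)
  then obtain d where d: "d > 0" "\<And>t. t \<ge> 0 \<Longrightarrow> \<bar>t - dist z a\<bar> < d \<Longrightarrow>
      \<bar>\<omega> t - \<omega> (dist z a) - \<omega>' (dist z a) * (t - dist z a)\<bar> \<le> e * \<bar>t - dist z a\<bar>"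
    using e unfolding has_derivative_within_alt by (force simp: real_norm_def)
  have "\<omega> (dist y a) \<le> \<omega> (dist z a) + (\<omega>' (dist z a) + e) * dist z y" if "dist y z < d" for y
  proof -
    let ?D = "\<bar>dist y a - dist z a\<bar>"
    have D: "?D \<le> dist z y"
      using dist_triangle2[of y a z] dist_triangle2[of z a y] dist_triangle[of y a z]
        dist_triangle[of z a y] by (simp add: dist_commute abs_le_iff)
    \<comment> \<open>The increment of the distance may be negative;
      \<open>\<omega>' \<ge> 0\<close> allows passing to its absolute value.\<close>
    have "\<omega>' (dist z a) * (dist y a - dist z a) \<le> \<omega>' (dist z a) * ?D"
      using growth_fun_deriv_nonneg[OF g] by (intro mult_left_mono) auto
    then have "\<omega> (dist y a) \<le> \<omega> (dist z a) + (\<omega>' (dist z a) + e) * ?D"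
      using d(2)[of "dist y a"] D that by (auto simp: dist_commute distrib_right)
    also have "\<dots> \<le> \<omega> (dist z a) + (\<omega>' (dist z a) + e) * dist z y"
      using growth_fun_deriv_nonneg[OF g, of "dist z a"] e D by (intro add_left_mono mult_left_mono) auto
    finally show ?thesis .
  qed
  with d(1) show ?thesis
    by (auto simp: eventually_nhds_metric)
qed

section \<open>Nearby points of small slope\<close>

text \<open>Here \<open>a\<close> and \<open>p\<close> stand for consecutive iterates and
  \<open>w\<close> for the dual element at \<open>p\<close>. The perturbed function \<open>h\<close>
  exceeds its lower bound at \<open>p\<close> by only \<open>2 * \<omega>1 (dist p a)\<close>, so
  Ekeland's principle with rate \<open>e\<close> applies at \<open>p\<close>.\<close>

lemma exists_near_point_small_slope:
  fixes f :: "'a::banach \<Rightarrow> ereal" and w :: "'a \<Rightarrow>\<^sub>L real"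
  assumes f: "closed_fun f" and fin: "\<bar>f p\<bar> \<noteq> \<infinity>"
    and g1: "growth_fun_deriv \<omega>1 \<omega>1'" and g2: "growth_fun_deriv \<omega>2 \<omega>2'"
    and lower: "\<And>y. f p + ereal (w (y - p) - \<omega>2 (dist y p) - \<omega>1 (dist y a) - \<omega>1 (dist p a)) \<le> f y"
    and e: "e > 0" "2 * \<omega>1 (dist p a) \<le> e * e"
  obtains z where "dist z p \<le> e"
    and "f z \<le> f p + ereal (\<omega>1 (dist p a) + norm w * e)"
    and "slope f z \<le> ereal (3 * e + norm w + \<omega>1' (dist z a) + \<omega>2' (dist z p))"
proof -
  define \<phi> where "\<phi> = (\<lambda>y. \<omega>2 (dist y p) + \<omega>1 (dist y a) - w (y - p))"
  define h where "h = (\<lambda>y. f y + ereal (\<phi> y))"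
  have \<omega>_nonneg: "0 \<le> \<omega>1 (dist y u)" "0 \<le> \<omega>2 (dist y u)" and \<omega>2_0: "\<omega>2 0 = 0" for y u
    using g1 g2 by (auto simp: growth_fun_deriv_def)
  obtain r where r: "f p = ereal r"
    using fin by auto
  have "continuous_on UNIV \<phi>"
    unfolding \<phi>_def
    by (intro continuous_intros growth_fun_deriv_continuous_dist[OF g1]
        growth_fun_deriv_continuous_dist[OF g2])
  then have h: "closed_fun h"
    unfolding h_def by (rule closed_fun_add_continuous[OF f])
  have h_ge: "ereal (r - \<omega>1 (dist p a)) \<le> h y" for y
    using lower[of y] r by (cases "f y") (auto simp: h_def \<phi>_def)
  have hp: "h p = ereal (r + \<omega>1 (dist p a))"
    using r \<omega>2_0 by (simp add: h_def \<phi>_def blinfun.zero_right)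
  then have "h p \<noteq> \<infinity>"
    by simp
  then obtain z where z: "h z + ereal (e * dist z p) \<le> h p"
    and min: "\<And>y. y \<noteq> z \<Longrightarrow> h z < h y + ereal (e * dist y z)"
    using ekeland_variational_principle[OF h h_ge _ e(1)] by metis
  obtain s where s: "f z = ereal s"
    using z hp f by (cases "f z") (auto simp: h_def closed_fun_def)
  \<comment> \<open>The drop of \<open>h\<close> from \<open>p\<close> to \<open>z\<close> is at
    most the gap, which is at most \<open>e * e\<close>; cancelling \<open>e\<close> gives the
    radius.\<close>
  have "e * dist z p \<le> 2 * \<omega>1 (dist p a)"
    using z h_ge[of z] hp s by (auto simp: h_def)
  then have dist: "dist z p \<le> e"
    using e by (metis mult_le_cancel_left_pos order.trans)
  have w_le: "w y \<le> norm w * norm y" for y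
    using norm_blinfun[of w y] by simp
  have "w (z - p) \<le> norm w * e"
    using w_le[of "z - p"] dist by (metis dist_norm mult_left_mono norm_ge_zero order.trans)
  moreover have "s + \<phi> z + e * dist z p \<le> r + \<omega>1 (dist p a)"
    using z hp s by (simp add: h_def)
  moreover have "0 \<le> e * dist z p"
    using e(1) by simp
  ultimately have "s \<le> r + (\<omega>1 (dist p a) + norm w * e)"
    using \<omega>_nonneg(1)[of z a] \<omega>_nonneg(2)[of z p] unfolding \<phi>_def by linarith
  then have fz: "f z \<le> f p + ereal (\<omega>1 (dist p a) + norm w * e)"
    using r s by simp
  \<comment> \<open>One \<open>e\<close> comes from Ekeland's inequality and one from the expansion
    of each growth function; the remaining terms bound the local rates of \<open>w\<close>,
    \<open>\<omega>1\<close> and \<open>\<omega>2\<close>.\<close>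
  have "slope f z \<le> ereal (3 * e + norm w + \<omega>1' (dist z a) + \<omega>2' (dist z p))" (is "_ \<le> ereal ?c")
  proof (rule slope_leI)
    show "\<bar>f z\<bar> \<noteq> \<infinity>"
      using s by simp
    show "0 \<le> ?c"
      using e(1) growth_fun_deriv_nonneg[OF g1] growth_fun_deriv_nonneg[OF g2] by simp
    have "\<forall>\<^sub>F y in nhds z. f z \<le> f y + ereal (?c * dist z y)"
      using growth_fun_deriv_eventually_le[OF g1 e(1), of a z]
        growth_fun_deriv_eventually_le[OF g2 e(1), of p z]
    proof eventually_elim
      case (elim y)
      have "h z \<le> h y + ereal (e * dist z y)"
        using min[of y] by (cases "y = z") (auto simp: dist_commute simp flip: zero_ereal_def)
      moreover have "w (y - p) = w (z - p) - w (z - y)"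
        by (simp add: blinfun.diff_right)
      moreover have "w (z - y) \<le> norm w * dist z y"
        using w_le by (simp add: dist_norm)
      ultimately show ?case
        using elim s by (cases "f y") (auto simp: h_def \<phi>_def algebra_simps)
    qed
    then show "\<forall>\<^sub>F y in at z. f z \<le> f y + ereal (?c * dist z y)"
      by (simp add: eventually_nhds_conv_at)
  qed
  with that dist fz show thesis
    by blast
qed

section \<open>Passage to the limit\<close>

lemma proper_growth_fun_small:
  assumes "proper_growth_fun \<omega>"
  obtains \<omega>' where "growth_fun_deriv \<omega> \<omega>'"
    and "\<And>e. e > 0 \<Longrightarrow> \<exists>d>0. \<forall>t. 0 \<le> t \<longrightarrow> t < d \<longrightarrow> \<omega> t < e \<and> \<omega>' t < e"
proof -
  obtain \<omega>' where g: "growth_fun_deriv \<omega> \<omega>'" and lim: "(\<omega>' \<longlongrightarrow> 0) (at_right 0)"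
    using assms by (auto simp: proper_growth_fun_def)
  have "\<exists>d>0. \<forall>t. 0 \<le> t \<longrightarrow> t < d \<longrightarrow> \<omega> t < e \<and> \<omega>' t < e" if e: "e > 0" for e
  proof -
    have "(\<omega> has_real_derivative \<omega>' 0) (at 0 within {0..})"
      using g unfolding growth_fun_deriv_def by blast
    then have "(\<omega> \<longlongrightarrow> \<omega> 0) (at 0 within {0..})"
      using DERIV_continuous continuous_within by blast
    moreover have zero: "\<omega> 0 = 0" "\<omega>' 0 = 0"
      using g by (auto simp: growth_fun_deriv_def)
    ultimately have "\<forall>\<^sub>F t in at 0 within {0..}. \<omega> t < e"
      using e by (intro order_tendstoD) auto
    then obtain d1 where d1: "d1 > 0" "\<And>t. 0 < t \<Longrightarrow> t < d1 \<Longrightarrow> \<omega> t < e"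
      by (force simp: eventually_at dist_real_def)
    have "\<forall>\<^sub>F t in at_right 0. \<omega>' t < e"
      using lim e by (rule order_tendstoD)
    then obtain d2 where d2: "d2 > 0" "\<And>t. 0 < t \<Longrightarrow> t < d2 \<Longrightarrow> \<omega>' t < e"
      by (auto simp: eventually_at_right_field)
    \<comment> \<open>The limits concern \<open>t > 0\<close> only; \<open>t = 0\<close> must be
      included because the distances involved can vanish.\<close>
    have "\<omega> t < e \<and> \<omega>' t < e" if "0 \<le> t" "t < min d1 d2" for t
      using that d1(2) d2(2) zero e by (cases "t = 0") auto
    moreover have "min d1 d2 > 0"
      using d1(1) d2(1) by simp
    ultimately show ?thesis
      by blast
  qed
  with g that show thesis
    by blast
qed

theorem corollary5p10:
  fixes f :: "'a::banach \<Rightarrow> ereal"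
    and x :: "nat \<Rightarrow> 'a"
    and fx :: "nat \<Rightarrow> 'a \<Rightarrow> ereal"
    and v :: "nat \<Rightarrow> 'a \<Rightarrow>\<^sub>L real"
    and \<omega>1 \<omega>2 :: "real \<Rightarrow> real"
    and xstar :: 'a
  assumes "closed_fun f"
    and "\<And>k. \<bar>f (x k)\<bar> \<noteq> \<infinity>"
    and "\<And>k. closed_fun (fx k)"
    and "proper_growth_fun \<omega>1"
    and "\<And>k y. ext_close (fx k y) (f y) (\<omega>1 (dist y (x k)))"
    and "proper_growth_fun \<omega>2"
    and "\<And>k y. fx k y \<ge> fx k (x (Suc k))
           + ereal (blinfun_apply (v (Suc k)) (y - x (Suc k)))
           - ereal (\<omega>2 (dist y (x (Suc k))))"
    and "(\<lambda>k. dist (x (Suc k)) (x k)) \<longlonglongrightarrow> 0"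
    and "(\<lambda>k. norm (v k)) \<longlonglongrightarrow> 0"
    and "\<bar>f xstar\<bar> \<noteq> \<infinity>"
    and "\<exists>r. strict_mono r \<and> ((\<lambda>k. (x k, f (x k))) \<circ> r) \<longlonglongrightarrow> (xstar, f xstar)"
  shows "stationary f xstar"
proof -
  note f = assms(1) and fin = assms(2) and close = assms(5) and model = assms(7)
  obtain \<omega>1' where g1: "growth_fun_deriv \<omega>1 \<omega>1'"
    and small1: "\<And>e. e > 0 \<Longrightarrow> \<exists>d>0. \<forall>t. 0 \<le> t \<longrightarrow> t < d \<longrightarrow> \<omega>1 t < e \<and> \<omega>1' t < e"
    by (rule proper_growth_fun_small[OF assms(4)]) (use that in blast)
  obtain \<omega>2' where g2: "growth_fun_deriv \<omega>2 \<omega>2'"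
    and small2: "\<And>e. e > 0 \<Longrightarrow> \<exists>d>0. \<forall>t. 0 \<le> t \<longrightarrow> t < d \<longrightarrow> \<omega>2 t < e \<and> \<omega>2' t < e"
    by (rule proper_growth_fun_small[OF assms(6)]) (use that in blast)
  \<comment> \<open>Closeness at \<open>y\<close>, the model inequality and closeness at
    \<open>x (Suc k)\<close> are chained. If \<open>f y\<close> is infinite the claim is trivial;
    otherwise \<open>ext_close\<close> makes all values finite.\<close>
  have lower: "f (x (Suc k)) + ereal (v (Suc k) (y - x (Suc k)) - \<omega>2 (dist y (x (Suc k)))
      - \<omega>1 (dist y (x k)) - \<omega>1 (dist (x (Suc k)) (x k))) \<le> f y" for k y
    using close[of k "x (Suc k)"] close[of k y] model[of k "y"] fin[of "Suc k"]
    by (cases "f (x (Suc k))"; cases "fx k (x (Suc k))"; cases "f y"; cases "fx k y")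
      (auto simp: ext_close_def)
  obtain r where r: "strict_mono r" and lim: "((\<lambda>k. (x k, f (x k))) \<circ> r) \<longlonglongrightarrow> (xstar, f xstar)"
    using assms(11) by blast
  have xlim: "(\<lambda>j. x (r j)) \<longlonglongrightarrow> xstar" and flim: "(\<lambda>j. f (x (r j))) \<longlonglongrightarrow> f xstar"
    using tendsto_fst[OF lim] tendsto_snd[OF lim] by (auto simp: o_def)
  have rlim: "filterlim r sequentially sequentially"
    using r by (rule filterlim_subseq)
  show ?thesis
  proof (rule stationaryI[OF f assms(10)])
    fix e :: real assume e: "e > 0"
    \<comment> \<open>The slope bound sums to less than \<open>6 * c\<close> and the excess in value
      to less than \<open>3 * c\<close>, so \<open>e / 8\<close> leaves room;
      \<open>c \<le> 1\<close> is for the product \<open>norm (v (Suc k)) * q\<close>.\<close>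
    define c where "c = min 1 (e / 8)"
    have c: "c > 0" "c \<le> 1" "8 * c \<le> e"
      using e by (auto simp: c_def)
    obtain d1 where d1: "d1 > 0" "\<And>t. 0 \<le> t \<Longrightarrow> t < d1 \<Longrightarrow> \<omega>1 t < c \<and> \<omega>1' t < c"
      using small1[OF c(1)] by blast
    obtain d2 where d2: "d2 > 0" "\<And>t. 0 \<le> t \<Longrightarrow> t < d2 \<Longrightarrow> \<omega>2 t < c \<and> \<omega>2' t < c"
      using small2[OF c(1)] by blast
    \<comment> \<open>\<open>q\<close> is the Ekeland rate and radius. The point \<open>z\<close> is
      within \<open>2 * q\<close> of \<open>x k\<close> and within \<open>q\<close> of
      \<open>x (Suc k)\<close>, so the factor 3 ensures strict bounds by \<open>d1\<close> and
      \<open>d2\<close>.\<close>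
    define q where "q = min c (min (d1 / 3) (d2 / 3))"
    have q: "q > 0" "q \<le> c" "3 * q \<le> d1" "3 * q \<le> d2"
      using c(1) d1(1) d2(1) by (auto simp: q_def)
    \<comment> \<open>This threshold provides the gap condition
      \<open>2 * \<omega>1 (dist p a) \<le> q * q\<close>.\<close>
    obtain d3 where d3: "d3 > 0" "\<And>t. 0 \<le> t \<Longrightarrow> t < d3 \<Longrightarrow> \<omega>1 t < q * q / 2"
      using small1[of "q * q / 2"] q(1) by auto
    have ev: "\<forall>\<^sub>F k in sequentially. dist (x (Suc k)) (x k) < min q d3" "\<forall>\<^sub>F k in sequentially. norm (v k) < c"
      using q(1) d3(1) c(1) by (auto simp del: min_less_iff_conj
          intro!: order_tendstoD(2)[OF assms(8)] order_tendstoD(2)[OF assms(9)])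
    \<comment> \<open>The subsequence index \<open>r j\<close> has to serve as \<open>Suc k\<close>,
      so the step condition is shifted by one; \<open>k > 0\<close> makes \<open>k - 1\<close> a
      true predecessor.\<close>
    have ev1: "\<forall>\<^sub>F k in sequentially. k > 0 \<and> dist (x k) (x (k - 1)) < min q d3 \<and> norm (v k) < c"
    proof -
      have "\<forall>\<^sub>F k in sequentially. dist (x k) (x (k - 1)) < min q d3"
        by (subst eventually_sequentially_Suc[symmetric]) (use ev(1) in simp)
      with ev(2) eventually_gt_at_top[of 0] show ?thesis
        by eventually_elim simp
    qed
    have "f xstar < f xstar + ereal c"
      using assms(10) c(1) by (cases "f xstar") auto
    with flim have "\<forall>\<^sub>F j in sequentially. f (x (r j)) < f xstar + ereal c"
      by (rule order_tendstoD)
    moreover have "\<forall>\<^sub>F j in sequentially. dist (x (r j)) xstar < c"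
      using xlim c(1) by (rule tendstoD)
    moreover have "\<forall>\<^sub>F j in sequentially. r j > 0 \<and> dist (x (r j)) (x (r j - 1)) < min q d3 \<and> norm (v (r j)) < c"
      using filterlim_iff[THEN iffD1, OF rlim] ev1 by blast
    ultimately have "\<forall>\<^sub>F j in sequentially. \<exists>k. f (x (Suc k)) < f xstar + ereal c \<and> dist (x (Suc k)) xstar < c
        \<and> dist (x (Suc k)) (x k) < min q d3 \<and> norm (v (Suc k)) < c"
    proof eventually_elim
      case (elim j)
      then show ?case
        by (intro exI[of _ "r j - 1"]) simp
    qed
    then obtain k where k: "f (x (Suc k)) < f xstar + ereal c" "dist (x (Suc k)) xstar < c"
        "dist (x (Suc k)) (x k) < q" "dist (x (Suc k)) (x k) < d3" "norm (v (Suc k)) < c"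
      by (auto dest: eventually_happens)
    have "2 * \<omega>1 (dist (x (Suc k)) (x k)) \<le> q * q"
      using d3(2)[of "dist (x (Suc k)) (x k)"] k(4) by simp
    then obtain z where z: "dist z (x (Suc k)) \<le> q"
      and fz: "f z \<le> f (x (Suc k)) + ereal (\<omega>1 (dist (x (Suc k)) (x k)) + norm (v (Suc k)) * q)"
      and slope: "slope f z \<le> ereal (3 * q + norm (v (Suc k)) + \<omega>1' (dist z (x k)) + \<omega>2' (dist z (x (Suc k))))"
      using exists_near_point_small_slope[OF f fin g1 g2 lower q(1)] by metis
    have "dist z (x k) < d1"
      using dist_triangle[of z "x k" "x (Suc k)"] z k(3) q by linarith
    then have "\<omega>1' (dist z (x k)) < c"
      using d1(2)[of "dist z (x k)"] by simp
    moreover have "\<omega>2' (dist z (x (Suc k))) < c"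
      using d2(2)[of "dist z (x (Suc k))"] z q by simp
    ultimately have "3 * q + norm (v (Suc k)) + \<omega>1' (dist z (x k)) + \<omega>2' (dist z (x (Suc k))) \<le> e"
      using k(5) q(2) c(1,3) by linarith
    with slope have "slope f z \<le> ereal e"
      by (meson ereal_less_eq(3) order.trans)
    moreover have "dist z xstar < e"
      using dist_triangle[of z xstar "x (Suc k)"] z k(2) q(2) c by linarith
    moreover have "f z < f xstar + ereal e"
    proof -
      have "\<omega>1 (dist (x (Suc k)) (x k)) < c"
        using d1(2)[of "dist (x (Suc k)) (x k)"] k(3) q by simp
      moreover have "norm (v (Suc k)) * q \<le> c"
        using mult_mono[of "norm (v (Suc k))" 1 q c] k(5) q(1,2) c(2) by simp
      ultimately have "\<omega>1 (dist (x (Suc k)) (x k)) + norm (v (Suc k)) * q + c < e"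
        using c by linarith
      with fz k(1) show ?thesis
        using assms(10) fin[of "Suc k"]
        by (cases "f z"; cases "f xstar"; cases "f (x (Suc k))") auto
    qed
    ultimately show "\<exists>y. dist y xstar < e \<and> f y < f xstar + ereal e \<and> slope f y \<le> ereal e"
      by blast
  qed
qed

end
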